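(* Let $n, r$ be integers with $n \geq 0$ and $r \geq 2$, and let $(S_1, S_2)$ be an Euler pair of order $r$. Then $c'_r(n) = b'_r(n)$.
   Context: $\mathbb N$ denotes the set of positive integers. A partition $\lambda$ of $n\ge 0$ is a non-increasing sequence of positive integers (its parts) with sum $n$. Write $\bar\ell(\lambda)$ for the number of different parts of $\lambda$ (parts counted without multiplicity). "A part is repeated at most $m$ times" (at least $m$ times, etc.) means that its multiplicity in the partition is at most $m$ (at least $m$, etc.). Let $r \ge 2$ and $S_1, S_2 \subseteq \mathbb N$. Let $\mathcal O_r(n)$ be the set of partitions of $n$ with all parts in $S_2$, and let $\mathcal D_r(n)$ be the set of partitions of $n$ with all parts in $S_1$ and each part repeated at most $r-1$ times. The pair $(S_1,S_2)$ is an Euler pair of order $r$ if $|\mathcal O_r(n)| = |\mathcal D_r(n)|$ for all $n \ge 0$; by a theorem of Subbarao, this is equivalent to $rS_1 \subseteq S_1$ and $S_2 = S_1 \setminus rS_1$, where $rS_1 = \{rm : m \in S_1\}$. Let $\mathcal D_{1,r}(n)$ be the set of partitions of $n$ with all parts in $S_1$ in which exactly one part (as a value) is repeated at least $r$ times. Let $\mathcal T_r(n)$ be the subset of $\mathcal D_{1,r}(n)$ consisting of those partitions in which one part is repeated more than $r$ times but less than $2r$ times (so all other parts are repeated at most $r-1$ times). Put $$c'_r(n) = |\mathcal T_r(n)|, \qquad b'_r(n) = \sum_{\lambda \in \mathcal D_r(n)} \bar\ell(\lambda) - \sum_{\lambda \in \mathcal O_r(n)} \bar\ell(\lambda).$$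 *)

theory Defs
  imports Complex_Main
begin

definition partitions :: "nat \<Rightarrow> nat list set" where
  "partitions n = {xs. sorted_wrt (\<ge>) xs \<and> (\<forall>x\<in>set xs. x > 0) \<and> sum_list xs = n}"

definition num_distinct_parts :: "nat list \<Rightarrow> nat" where
  "num_distinct_parts xs = card (set xs)"

definition part_O :: "nat set \<Rightarrow> nat \<Rightarrow> nat list set" where
  "part_O S2 n = {xs \<in> partitions n. set xs \<subseteq> S2}"

definition part_D :: "nat set \<Rightarrow> nat \<Rightarrow> nat \<Rightarrow> nat list set" where
  "part_D S1 r n = {xs \<in> partitions n. set xs \<subseteq> S1 \<and> (\<forall>x\<in>set xs. count_list xs x \<le> r - 1)}"

text \<open>The counting definition; the description of these pairs as those with
  \<open>r S1 \<subseteq> S1\<close> and \<open>S2 = S1 - r S1\<close> is a theorem of Subbarao.\<close>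

definition Euler_pair :: "nat \<Rightarrow> nat set \<Rightarrow> nat set \<Rightarrow> bool" where
  "Euler_pair r S1 S2 \<longleftrightarrow>
     S1 \<subseteq> {0<..} \<and> S2 \<subseteq> {0<..} \<and> (\<forall>n. card (part_O S2 n) = card (part_D S1 r n))"

definition part_D1 :: "nat set \<Rightarrow> nat \<Rightarrow> nat \<Rightarrow> nat list set" where
  "part_D1 S1 r n =
     {xs \<in> partitions n. set xs \<subseteq> S1 \<and> (\<exists>!x. x \<in> set xs \<and> r \<le> count_list xs x)}"

definition part_T :: "nat set \<Rightarrow> nat \<Rightarrow> nat \<Rightarrow> nat list set" where
  "part_T S1 r n =
     {xs \<in> part_D1 S1 r n. \<exists>x\<in>set xs. r < count_list xs x \<and> count_list xs x < 2 * r}"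

definition c' :: "nat set \<Rightarrow> nat \<Rightarrow> nat \<Rightarrow> nat" where
  "c' S1 r n = card (part_T S1 r n)"

definition b' :: "nat set \<Rightarrow> nat set \<Rightarrow> nat \<Rightarrow> nat \<Rightarrow> int" where
  "b' S1 S2 r n = (\<Sum>xs\<in>part_D S1 r n. int (num_distinct_parts xs))
                 - (\<Sum>xs\<in>part_O S2 n. int (num_distinct_parts xs))"

lemma finite_partitions: "finite (partitions n)"
proof (rule finite_subset)
  have "length xs \<le> sum_list xs" if "\<forall>x\<in>set xs. x > 0" for xs :: "nat list"
    using that by (induction xs) (auto simp: Suc_le_eq intro: add_less_le_mono)
  moreover have "x \<le> sum_list xs" if "x \<in> set xs" for x and xs :: "nat list"
    using that by (simp add: member_le_sum_list)
  ultimately show "partitions n \<subseteq> {xs. set xs \<subseteq> {..n} \<and> length xs \<le> n}"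
    unfolding partitions_def by blast
  show "finite {xs. set xs \<subseteq> {..n} \<and> length xs \<le> n}"
    by (rule finite_lists_length_le) simp
qed

end

theory Submission
  imports Defs "HOL-Computational_Algebra.Formal_Power_Series" "HOL-Library.Multiset"
begin

text \<open>
  Let \<open>P(q)\<close> be the common generating function of the two families of an Euler pair. Splitting off
  the factor of a single part \<open>s\<close> expresses every statistic of the multiplicity of \<open>s\<close> as \<open>P(q)\<close>
  times a power series in \<open>q\<^sup>s\<close>. For the number of different parts this gives
  \<open>P(q) \<Sum>\<^sub>s q\<^sup>s\<close>, summed over \<open>S2\<close>, on the \<open>S2\<close> side. On the \<open>S1\<close> side, after subtracting the
  generating function of \<open>c'\<close>, it gives \<open>P(q) \<Sum>\<^sub>s (q\<^sup>s - q\<^bsup>rs\<^esup>)\<close>, summed over \<open>S1\<close>. So it suffices that the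
  indicator functions satisfy \<open>1\<^bsub>S1\<^esub> - 1\<^bsub>rS1\<^esub> = 1\<^bsub>S2\<^esub>\<close>. This follows by comparing the two expressions
  for \<open>q P'(q)/P(q)\<close>, which are Lambert series whose coefficients are determined recursively.
\<close>

unbundle fps_syntax

section \<open>Partitions with a prescribed set of multiplicities\<close>

text \<open>A common form of both families of an Euler pair: \<open>Q = UNIV\<close> gives
  \<open>part_O\<close>, and \<open>Q = {..<r}\<close> gives \<open>part_D\<close>.\<close>

definition restricted_partitions :: "nat set \<Rightarrow> nat set \<Rightarrow> nat \<Rightarrow> nat list set" where
  "restricted_partitions Q S n =
     {xs \<in> partitions n. set xs \<subseteq> S \<and> (\<forall>x\<in>set xs. count_list xs x \<in> Q)}"

definition partition_gf :: "nat set \<Rightarrow> nat set \<Rightarrow> int fps" where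
  "partition_gf Q S = Abs_fps (\<lambda>n. int (card (restricted_partitions Q S n)))"

lemma fps_compose_X_power_nth:
  fixes f :: "'a::comm_ring_1 fps"
  assumes "s > 0"
  shows "(f oo fps_X ^ s) $ n = (if s dvd n then f $ (n div s) else 0)"
proof -
  have "(f oo fps_X ^ s) $ n = (\<Sum>i=0..n. if n = s * i then f $ i else 0)"
    by (auto simp: fps_compose_nth power_mult[symmetric] fps_X_power_nth intro!: sum.cong)
  also have "\<dots> = (\<Sum>i=0..n. if i = n div s then (if s dvd n then f $ i else 0) else 0)"
    using assms by (intro sum.cong) auto
  also have "\<dots> = (if s dvd n then f $ (n div s) else 0)"
    by simp
  finally show ?thesis .
qed

section \<open>Splitting off all copies of one part\<close>

lemma sorted_desc_eqI:
  fixes xs ys :: "nat list"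
  assumes "sorted_wrt (\<ge>) xs" "sorted_wrt (\<ge>) ys" "mset xs = mset ys"
  shows "xs = ys"
proof -
  have "sorted (rev xs)" "sorted (rev ys)" "mset (rev xs) = mset (rev ys)"
    using assms by (auto simp: sorted_wrt_rev)
  then have "rev xs = rev ys"
    by (metis properties_for_sort)
  then show ?thesis by simp
qed

lemma count_list_filter: "count_list (filter P xs) x = (if P x then count_list xs x else 0)"
  by (induction xs) auto

lemma count_list_pos_iff: "count_list xs x > 0 \<longleftrightarrow> x \<in> set xs"
  using count_list_0_iff[of xs x] by auto

lemma sum_list_filter_neq:
  "sum_list xs = sum_list (filter (\<lambda>x. x \<noteq> s) xs) + count_list xs s * (s::nat)"
  by (induction xs) auto

text \<open>The inverse inserts \<open>k\<close> copies of \<open>s\<close> and sorts again; no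
  other multiplicity changes. The multiplicity of \<open>s\<close> is exempt from \<open>Q\<close>,
  so that one part may later be repeated more often than the others.\<close>

lemma bij_betw_remove_part:
  assumes "s > 0" "s \<in> S"
  shows "bij_betw (filter (\<lambda>x. x \<noteq> s))
    {xs \<in> partitions (i + k * s). set xs \<subseteq> S \<and> (\<forall>x\<in>set xs - {s}. count_list xs x \<in> Q) \<and>
       count_list xs s = k}
    (restricted_partitions Q (S - {s}) i)"
    (is "bij_betw ?f ?A ?B")
proof (rule bij_betw_byWitness[where f' = "\<lambda>ys. rev (sort (replicate k s @ ys))"])
  let ?g = "\<lambda>ys. rev (sort (replicate k s @ ys))"
  have mset_split: "mset xs = replicate_mset (count_list xs s) s + mset (?f xs)" for xs
    by (rule multiset_eqI) (simp add: count_mset count_list_filter)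
  show "\<forall>xs\<in>?A. ?g (?f xs) = xs"
  proof
    fix xs assume "xs \<in> ?A"
    then show "?g (?f xs) = xs"
      using mset_split[of xs]
      by (intro sorted_desc_eqI) (auto simp: partitions_def sorted_wrt_rev simp del: mset_filter)
  qed
  have g_f: "?f (?g ys) = ys" if "ys \<in> ?B" for ys
  proof (rule sorted_desc_eqI)
    show "sorted_wrt (\<ge>) (?f (?g ys))"
      by (intro sorted_wrt_filter) (simp add: sorted_wrt_rev)
    show "sorted_wrt (\<ge>) ys"
      using that by (simp add: restricted_partitions_def partitions_def)
    show "mset (?f (?g ys)) = mset ys"
      using that
      by (intro multiset_eqI) (auto simp: restricted_partitions_def count_mset count_list_0_iff)
  qed
  then show "\<forall>ys\<in>?B. ?f (?g ys) = ys" by blast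
  show "?f ` ?A \<subseteq> ?B"
  proof (rule image_subsetI)
    fix xs assume "xs \<in> ?A"
    then show "?f xs \<in> ?B"
      using sum_list_filter_neq[of xs s]
      by (auto simp: restricted_partitions_def partitions_def count_list_filter
          intro: sorted_wrt_filter)
  qed
  show "?g ` ?B \<subseteq> ?A"
  proof (rule image_subsetI)
    fix ys assume ys: "ys \<in> ?B"
    have cnt: "count_list (?g ys) x = (if x = s then k else 0) + count_list ys x" for x
      by (simp flip: count_mset)
    have "s \<notin> set ys"
      using ys by (auto simp: restricted_partitions_def)
    then have "count_list ys s = 0" by (simp add: count_list_0_iff)
    moreover have "sum_list (?g ys) = i + k * s"
    proof -
      have "sum_list (?g ys) = sum_mset (mset (?g ys))"
        by (simp only: sum_mset_sum_list)
      also have "\<dots> = k * s + sum_list ys"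
        by (simp add: sum_mset_sum_list sum_list_replicate)
      finally show ?thesis using ys by (simp add: restricted_partitions_def partitions_def)
    qed
    ultimately show "?g ys \<in> ?A"
      using ys assms unfolding mem_Collect_eq cnt
      by (auto simp: restricted_partitions_def partitions_def sorted_wrt_rev split: if_splits)
  qed
qed

text \<open>Grouping the partitions by the sum \<open>i\<close> of their parts other than
  \<open>s\<close> turns the weighted sum into a Cauchy product: the copies of \<open>s\<close>
  account for \<open>n - i\<close>. The multiplicity of \<open>s\<close> is constrained by the
  weight alone.\<close>

lemma weighted_partition_sum:
  assumes "s > 0" "s \<in> S"
  shows "(\<Sum>xs\<in>{xs \<in> partitions n. set xs \<subseteq> S \<and> (\<forall>x\<in>set xs - {s}. count_list xs x \<in> Q)}.
            w (count_list xs s))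
       = (partition_gf Q (S - {s}) * (Abs_fps w oo fps_X ^ s)) $ n"
    (is "sum _ ?B = _")
proof -
  let ?h = "\<lambda>xs. sum_list (filter (\<lambda>x. x \<noteq> s) xs)"
  have n: "n = ?h xs + count_list xs s * s" if "xs \<in> ?B" for xs
    using that sum_list_filter_neq[of xs s] by (simp add: partitions_def)
  have inner: "(\<Sum>xs\<in>{xs. xs \<in> ?B \<and> ?h xs = i}. w (count_list xs s))
      = partition_gf Q (S - {s}) $ i * (Abs_fps w oo fps_X ^ s) $ (n - i)"
    if i: "i \<in> {0..n}" for i
  proof (cases "s dvd n - i")
    case False
    then have "{xs. xs \<in> ?B \<and> ?h xs = i} = {}"
      using n by fastforce
    with False show ?thesis
      using \<open>s > 0\<close> by (simp only: fps_compose_X_power_nth) simp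
  next
    case True
    then obtain k where "n - i = k * s" by (metis dvd_def mult.commute)
    with i have k: "n = i + k * s" by simp
    \<comment> \<open>Since \<open>s > 0\<close>, the sum \<open>i\<close> of the other parts forces
      the multiplicity \<open>k\<close> of \<open>s\<close>, so the weight is constant on this
      class.\<close>
    have "{xs. xs \<in> ?B \<and> ?h xs = i} =
      {xs \<in> partitions (i + k * s). set xs \<subseteq> S \<and> (\<forall>x\<in>set xs - {s}. count_list xs x \<in> Q) \<and>
         count_list xs s = k}" (is "_ = ?C")
      using n \<open>s > 0\<close> k by fastforce
    moreover have "card ?C = card (restricted_partitions Q (S - {s}) i)"
      by (rule bij_betw_same_card[OF bij_betw_remove_part[OF assms]])
    moreover have "(\<Sum>xs\<in>?C. w (count_list xs s)) = (\<Sum>xs\<in>?C. w k)"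
      by (rule sum.cong) auto
    ultimately show ?thesis
      using \<open>s > 0\<close> k by (simp add: fps_compose_X_power_nth partition_gf_def)
  qed
  have "finite ?B" using finite_partitions by simp
  moreover have "?h ` ?B \<subseteq> {0..n}"
    using n by fastforce
  ultimately have "(\<Sum>xs\<in>?B. w (count_list xs s)) =
      (\<Sum>i\<in>{0..n}. \<Sum>xs\<in>{xs. xs \<in> ?B \<and> ?h xs = i}. w (count_list xs s))"
    by (intro sum.group[symmetric]) auto
  also have "\<dots> = (\<Sum>i=0..n. partition_gf Q (S - {s}) $ i * (Abs_fps w oo fps_X ^ s) $ (n - i))"
    by (rule sum.cong[OF refl inner])
  finally show ?thesis by (simp add: fps_mult_nth)
qed


section \<open>The factor of a single part\<close>

text \<open>With \<open>q^s\<close> substituted for \<open>q\<close>, this is the factor of the part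
  \<open>s\<close> in the product formula for \<open>partition_gf Q S\<close>, for
  \<open>0 \<in> Q\<close>. Factors are removed one at a time, so no infinite product is
  formed.\<close>

definition multiplicity_gf :: "nat set \<Rightarrow> int fps" where
  "multiplicity_gf Q = Abs_fps (\<lambda>k. if k \<in> Q then 1 else 0)"

lemma restricted_partitions_weighted_sum:
  assumes "s > 0" "s \<in> S" "0 \<in> Q"
  shows "(\<Sum>xs\<in>restricted_partitions Q S n. w (count_list xs s))
       = (partition_gf Q (S - {s}) * (Abs_fps (\<lambda>k. if k \<in> Q then w k else 0) oo fps_X ^ s)) $ n"
proof -
  let ?B = "{xs \<in> partitions n. set xs \<subseteq> S \<and> (\<forall>x\<in>set xs - {s}. count_list xs x \<in> Q)}"
  have "finite ?B" using finite_partitions by simp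
  moreover have "restricted_partitions Q S n = {xs \<in> ?B. count_list xs s \<in> Q}"
  proof -
    \<comment> \<open>An absent part has multiplicity 0, so \<open>0 \<in> Q\<close> makes the
      condition at \<open>s\<close> the same whether or not \<open>s\<close> occurs.\<close>
    have "count_list xs s \<in> Q" if "s \<notin> set xs" for xs
      using that \<open>0 \<in> Q\<close> by (simp add: count_list_0_iff)
    then show ?thesis unfolding restricted_partitions_def by blast
  qed
  ultimately have "(\<Sum>xs\<in>restricted_partitions Q S n. w (count_list xs s)) =
      (\<Sum>xs\<in>?B. if count_list xs s \<in> Q then w (count_list xs s) else 0)"
    by (simp only: sum.inter_filter)
  then show ?thesis
    using weighted_partition_sum[OF assms(1,2), where w = "\<lambda>k. if k \<in> Q then w k else 0"] by simp
qed

lemma partition_gf_remove_part: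
  assumes "s > 0" "s \<in> S" "0 \<in> Q"
  shows "partition_gf Q S = partition_gf Q (S - {s}) * (multiplicity_gf Q oo fps_X ^ s)"
  using restricted_partitions_weighted_sum[OF assms, where w = "\<lambda>_. 1"]
  by (intro fps_ext) (simp add: multiplicity_gf_def, simp add: partition_gf_def)

text \<open>Once a weight series has \<open>multiplicity_gf Q\<close> as a factor, that factor
  restores the part \<open>s\<close>, and the dependence on \<open>S - {s}\<close>
  disappears.\<close>

lemma partition_gf_mult_compose:
  assumes "s > 0" "s \<in> S" "0 \<in> Q"
  shows "partition_gf Q (S - {s}) * ((multiplicity_gf Q * K) oo fps_X ^ s)
       = partition_gf Q S * (K oo fps_X ^ s)"
  using assms by (simp add: partition_gf_remove_part fps_compose_mult_distrib mult.assoc)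

lemma parts_le_sum: "xs \<in> partitions n \<Longrightarrow> set xs \<subseteq> {1..n}"
  by (auto simp: partitions_def Suc_le_eq intro: member_le_sum_list)

section \<open>Partition statistics as sums over the part sizes\<close>

lemma sum_num_distinct_parts:
  "(\<Sum>xs\<in>restricted_partitions Q S n. int (num_distinct_parts xs))
     = (\<Sum>s\<in>S \<inter> {1..n}. \<Sum>xs\<in>restricted_partitions Q S n. of_bool (count_list xs s > 0))"
proof -
  have "int (num_distinct_parts xs) = (\<Sum>s\<in>S \<inter> {1..n}. of_bool (count_list xs s > 0))"
    if "xs \<in> restricted_partitions Q S n" for xs
  proof -
    have "set xs \<subseteq> S \<inter> {1..n}"
      using that parts_le_sum by (auto simp: restricted_partitions_def)
    then have "(S \<inter> {1..n}) \<inter> {s. count_list xs s > 0} = set xs"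
      by (auto simp: count_list_pos_iff)
    then show ?thesis
      by (simp add: num_distinct_parts_def of_bool_def sum.If_cases)
  qed
  then show ?thesis
    by (subst sum.swap) (rule sum.cong[OF refl])
qed

text \<open>The left side is the coefficient of \<open>q P'(q)\<close>. Each partition has size
  \<open>n\<close>, the sum of its part sizes times their multiplicities; the two summations are
  then exchanged.\<close>

lemma partition_gf_size_sum:
  "int n * partition_gf Q S $ n
     = (\<Sum>s\<in>S \<inter> {1..n}. int s * (\<Sum>xs\<in>restricted_partitions Q S n. int (count_list xs s)))"
proof -
  have "int n = (\<Sum>s\<in>S \<inter> {1..n}. int s * int (count_list xs s))"
    if "xs \<in> restricted_partitions Q S n" for xs
  proof -
    have "set xs \<subseteq> S \<inter> {1..n}"
      using that parts_le_sum by (auto simp: restricted_partitions_def)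
    then have "sum_list (map (\<lambda>x. x) xs) = (\<Sum>s\<in>S \<inter> {1..n}. count_list xs s * s)"
      by (intro sum_list_map_eq_sum_count2) auto
    then have "n = (\<Sum>s\<in>S \<inter> {1..n}. s * count_list xs s)"
      using that by (simp add: restricted_partitions_def partitions_def mult.commute)
    then have "int n = int (\<Sum>s\<in>S \<inter> {1..n}. s * count_list xs s)" by (rule arg_cong)
    then show ?thesis by simp
  qed
  then have "(\<Sum>xs\<in>restricted_partitions Q S n. int n) = (\<Sum>xs\<in>restricted_partitions Q S n.
      \<Sum>s\<in>S \<inter> {1..n}. int s * int (count_list xs s))"
    by (rule sum.cong[OF refl])
  also have "\<dots> = (\<Sum>s\<in>S \<inter> {1..n}. int s *
      (\<Sum>xs\<in>restricted_partitions Q S n. int (count_list xs s)))"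
    by (subst sum.swap) (simp add: sum_distrib_left)
  finally show ?thesis by (simp add: partition_gf_def mult.commute)
qed

lemma part_D_eq: "r > 0 \<Longrightarrow> part_D S r n = restricted_partitions {..<r} S n"
  by (auto simp: part_D_def restricted_partitions_def)

lemma part_O_eq: "part_O S n = restricted_partitions UNIV S n"
  by (simp add: part_O_def restricted_partitions_def)

text \<open>Partitions are classified by their unique part \<open>s\<close> repeated at least
  \<open>r\<close> times; its multiplicity is selected by the weight, while all other parts stay
  below \<open>r\<close>.\<close>

lemma card_part_T:
  assumes "S \<subseteq> {0<..}"
  shows "int (card (part_T S r n)) = (\<Sum>s\<in>S \<inter> {1..n}. (partition_gf {..<r} (S - {s}) *
       (Abs_fps (\<lambda>k. of_bool (r < k \<and> k < 2 * r)) oo fps_X ^ s)) $ n)"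
proof -
  define B where "B s = {xs \<in> partitions n. set xs \<subseteq> S \<and>
    (\<forall>x\<in>set xs - {s}. count_list xs x \<in> {..<r})}" for s
  define T where "T s = {xs \<in> B s. r < count_list xs s \<and> count_list xs s < 2 * r}" for s
  have fin: "finite (B s)" for s
    using finite_partitions by (simp add: B_def)
  have mem: "s \<in> set xs" if "r < count_list xs s" for s :: nat and xs
    using that by (simp flip: count_list_pos_iff)
  have "part_T S r n = (\<Union>s\<in>S \<inter> {1..n}. T s)"
  proof (intro equalityI subsetI)
    fix xs assume "xs \<in> part_T S r n"
    then obtain s where s: "s \<in> set xs" "r < count_list xs s" "count_list xs s < 2 * r"
      and xs: "xs \<in> partitions n" "set xs \<subseteq> S"
      and ex: "\<exists>!x. x \<in> set xs \<and> r \<le> count_list xs x"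
      by (auto simp: part_T_def part_D1_def)
    have "\<forall>x\<in>set xs - {s}. count_list xs x < r"
      using ex s by (metis DiffE less_imp_le not_le singletonI)
    with s xs have "xs \<in> T s" by (simp add: T_def B_def)
    moreover have "s \<in> S \<inter> {1..n}" using s xs parts_le_sum by blast
    ultimately show "xs \<in> (\<Union>s\<in>S \<inter> {1..n}. T s)" by blast
  next
    fix xs assume "xs \<in> (\<Union>s\<in>S \<inter> {1..n}. T s)"
    then obtain s where s: "xs \<in> T s" by blast
    then have s_in: "s \<in> set xs" using mem by (simp add: T_def)
    have "\<forall>x\<in>set xs - {s}. \<not> r \<le> count_list xs x"
      using s by (simp add: T_def B_def not_le)
    then have "\<exists>!x. x \<in> set xs \<and> r \<le> count_list xs x"
      using s s_in by (intro ex1I[of _ s]) (auto simp: T_def)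
    with s s_in show "xs \<in> part_T S r n"
      by (auto simp: T_def B_def part_T_def part_D1_def)
  qed
  \<comment> \<open>In \<open>T s\<close> the part \<open>s\<close> occurs more than
    \<open>r\<close> times, whereas \<open>T t\<close> allows it fewer than \<open>r\<close>
    times.\<close>
  moreover have "T s \<inter> T t = {}" if "s \<noteq> t" for s t
  proof -
    have False if xs: "xs \<in> T s" "xs \<in> T t" for xs
    proof -
      have "s \<in> set xs - {t}" using xs(1) mem \<open>s \<noteq> t\<close> by (simp add: T_def)
      with xs(2) have "count_list xs s < r" by (simp add: T_def B_def)
      with xs(1) show False by (simp add: T_def)
    qed
    then show ?thesis by blast
  qed
  ultimately have "int (card (part_T S r n)) = (\<Sum>s\<in>S \<inter> {1..n}. int (card (T s)))"
    using fin by (simp add: card_UN_disjoint T_def)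
  also have "\<dots> = (\<Sum>s\<in>S \<inter> {1..n}. \<Sum>xs\<in>B s.
      of_bool (r < count_list xs s \<and> count_list xs s < 2 * r))"
    using fin by (simp add: T_def of_bool_def sum.inter_filter[symmetric])
  also have "\<dots> = (\<Sum>s\<in>S \<inter> {1..n}. (partition_gf {..<r} (S - {s}) *
       (Abs_fps (\<lambda>k. of_bool (r < k \<and> k < 2 * r)) oo fps_X ^ s)) $ n)"
    unfolding B_def using assms
    by (intro sum.cong weighted_partition_sum[where w = "\<lambda>k. of_bool (r < k \<and> k < 2 * r)"]) auto
  finally show ?thesis .
qed

section \<open>Rational forms and logarithmic derivatives of the factors\<close>

text \<open>This is \<open>q/(1 - q)\<close>; composed with \<open>q^m\<close> it becomes the
  Lambert term \<open>q^m/(1 - q^m)\<close>.\<close>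

definition geometric_fps :: "int fps" where
  "geometric_fps = Abs_fps (\<lambda>k. of_bool (k > 0))"

lemma geometric_fps_mult: "geometric_fps * (1 - fps_X) = fps_X"
  by (rule fps_ext) (auto simp: geometric_fps_def right_diff_distrib)

lemma multiplicity_gf_lessThan_mult:
  "multiplicity_gf {..<r} * (1 - fps_X) = 1 - fps_X ^ r"
  by (rule fps_ext) (auto simp: multiplicity_gf_def algebra_simps fps_X_power_nth)

lemma multiplicity_gf_UNIV_mult: "multiplicity_gf UNIV * (1 - fps_X) = 1"
  by (rule fps_ext) (auto simp: multiplicity_gf_def algebra_simps)

lemma one_minus_X_power_neq_0: "r > 0 \<Longrightarrow> 1 - fps_X ^ r \<noteq> (0 :: int fps)"
  by (auto dest!: fps_eq_iff[THEN iffD1] spec[of _ 0] simp: fps_X_power_nth)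

lemma multiplicity_gf_deriv:
  "Abs_fps (\<lambda>k. if k \<in> Q then int k else 0) = fps_X * fps_deriv (multiplicity_gf Q)"
  by (rule fps_ext) (auto simp: multiplicity_gf_def)

lemma one_minus_X_mult_deriv:
  fixes g :: "int fps"
  assumes "g * (1 - fps_X) = h"
  shows "fps_deriv g * (1 - fps_X) = g + fps_deriv h"
  using arg_cong[OF assms, of fps_deriv] by (simp add: algebra_simps)

text \<open>Logarithmic differentiation of \<open>(1 - q^r)/(1 - q)\<close>. Over the integers both
  denominators are cleared by multiplication and cancelled at the end, as they are nonzero in an
  integral domain.\<close>

lemma multiplicity_gf_lessThan_deriv:
  assumes "r > 0"
  shows "fps_X * fps_deriv (multiplicity_gf {..<r})
       = multiplicity_gf {..<r} * (geometric_fps - of_nat r * (geometric_fps oo fps_X ^ r))"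
    (is "_ * ?G' = ?G * (?L - _ * ?Lr)")
proof -
  have Lr: "?Lr * (1 - fps_X ^ r) = fps_X ^ r"
    using arg_cong[OF geometric_fps_mult, of "\<lambda>f. f oo fps_X ^ r"] assms
    by (simp add: fps_compose_mult_distrib fps_compose_sub_distrib)
  have X: "fps_X * fps_X ^ (r - 1) = (fps_X ^ r :: int fps)"
    using assms by (metis power_eq_if not_gr0)
  have "?G' * (1 - fps_X) = ?G - of_nat r * fps_X ^ (r - 1)"
    using one_minus_X_mult_deriv[OF multiplicity_gf_lessThan_mult[of r]]
    by (simp add: fps_deriv_power')
  then have "fps_X * ?G' * (1 - fps_X) = fps_X * (?G - of_nat r * fps_X ^ (r - 1))"
    by (simp only: mult.assoc)
  also have "\<dots> = fps_X * ?G - of_nat r * fps_X ^ r"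
    by (simp only: right_diff_distrib X mult.left_commute[of fps_X "of_nat r"])
  finally have "fps_X * ?G' * (1 - fps_X) * (1 - fps_X ^ r)
      = fps_X * ?G * (1 - fps_X ^ r) - of_nat r * fps_X ^ r * (?G * (1 - fps_X))"
    by (simp add: multiplicity_gf_lessThan_mult left_diff_distrib)
  also have "\<dots> = ?G * (?L * (1 - fps_X)) * (1 - fps_X ^ r)
      - of_nat r * (?Lr * (1 - fps_X ^ r)) * (?G * (1 - fps_X))"
    by (simp only: geometric_fps_mult Lr mult.commute)
  also have "\<dots> = ?G * (?L - of_nat r * ?Lr) * (1 - fps_X) * (1 - fps_X ^ r)"
    by (simp only: algebra_simps)
  finally show ?thesis
    using one_minus_X_power_neq_0[OF assms] one_minus_X_power_neq_0[of 1] by simp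
qed

lemma multiplicity_gf_UNIV_deriv:
  "fps_X * fps_deriv (multiplicity_gf UNIV) = multiplicity_gf UNIV * geometric_fps"
proof -
  have "fps_X * fps_deriv (multiplicity_gf UNIV) * (1 - fps_X) = fps_X * multiplicity_gf UNIV"
    using one_minus_X_mult_deriv[OF multiplicity_gf_UNIV_mult] by (simp add: mult.assoc)
  also have "\<dots> = multiplicity_gf UNIV * geometric_fps * (1 - fps_X)"
    by (simp add: mult.assoc geometric_fps_mult mult.commute)
  finally show ?thesis
    using one_minus_X_power_neq_0[of 1] by simp
qed

lemma positive_multiplicity_UNIV:
  "Abs_fps (\<lambda>k. if k \<in> UNIV then of_bool (k > 0) else 0) = multiplicity_gf UNIV * fps_X"
  by (rule fps_ext) (auto simp: multiplicity_gf_def)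

text \<open>The right side is \<open>(q + ... + q^r) - (q^r + ... + q^(2r-1))\<close>. The terms
  \<open>q^r\<close> cancel, which is why the multiplicities counted by \<open>c'\<close> lie
  strictly between \<open>r\<close> and \<open>2 * r\<close>.\<close>

lemma positive_multiplicity_lessThan:
  assumes "r > 0"
  shows "Abs_fps (\<lambda>k. if k \<in> {..<r} then of_bool (k > 0) else 0)
         - Abs_fps (\<lambda>k. of_bool (r < k \<and> k < 2 * r))
       = multiplicity_gf {..<r} * (fps_X - fps_X ^ r)"
  using assms
  by (intro fps_ext) (auto simp: multiplicity_gf_def right_diff_distrib fps_X_power_mult_right_nth)


section \<open>Truncated sums and leading coefficients of Lambert terms\<close>

text \<open>Substituting \<open>m = r * s\<close> is injective; the products beyond \<open>n\<close>
  that it creates contribute zero.\<close>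

lemma sum_dilate:
  fixes f :: "nat \<Rightarrow> int"
  assumes "r > 0" "S \<subseteq> {0<..}" "\<And>m. m > n \<Longrightarrow> f m = 0"
  shows "(\<Sum>s\<in>S \<inter> {1..n}. f (r * s)) = (\<Sum>m\<in>(*) r ` S \<inter> {1..n}. f m)"
proof -
  have "(\<Sum>s\<in>S \<inter> {1..n}. f (r * s)) = (\<Sum>m\<in>(*) r ` (S \<inter> {1..n}). f m)"
    using \<open>r > 0\<close> by (subst sum.reindex) (auto simp: inj_on_def)
  also have "\<dots> = (\<Sum>m\<in>(*) r ` S \<inter> {1..n}. f m)"
  proof (rule sum.mono_neutral_right)
    show "(*) r ` S \<inter> {1..n} \<subseteq> (*) r ` (S \<inter> {1..n})"
    proof
      fix m assume "m \<in> (*) r ` S \<inter> {1..n}"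
      then obtain s where s: "s \<in> S" "m = r * s" "r * s \<le> n" by auto
      have "s \<le> r * s" using \<open>r > 0\<close> by simp
      also note \<open>r * s \<le> n\<close>
      finally have "s \<in> S \<inter> {1..n}" using s \<open>S \<subseteq> {0<..}\<close> by (auto simp: Suc_le_eq)
      with s show "m \<in> (*) r ` (S \<inter> {1..n})" by blast
    qed
    show "\<forall>m\<in>(*) r ` (S \<inter> {1..n}) - (*) r ` S \<inter> {1..n}. f m = 0"
    proof
      fix m assume "m \<in> (*) r ` (S \<inter> {1..n}) - (*) r ` S \<inter> {1..n}"
      then have "m > n" using \<open>r > 0\<close> by (auto simp: Suc_le_eq)
      then show "f m = 0" by (rule assms)
    qed
  qed auto
  finally show ?thesis .
qed

lemma sum_Int_of_bool:
  fixes f :: "nat \<Rightarrow> int"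
  shows "(\<Sum>m\<in>A \<inter> {1..n}. f m) = (\<Sum>m=1..n. of_bool (m \<in> A) * f m)"
  unfolding Int_commute[of A "{1..n}"]
  by (subst sum.inter_restrict) (simp_all add: of_bool_def if_distrib[of "\<lambda>c. c * _"] cong: if_cong)

lemma partition_gf_nth_0: "partition_gf Q S $ 0 = 1"
proof -
  have "restricted_partitions Q S 0 = {[]}"
    using parts_le_sum[of _ 0] by (auto simp: restricted_partitions_def) (auto simp: partitions_def)
  then show ?thesis by (simp add: partition_gf_def)
qed

lemma geometric_fps_compose:
  assumes "m > 0"
  shows "geometric_fps oo fps_X ^ m = fps_X ^ m * (multiplicity_gf UNIV oo fps_X ^ m)"
proof -
  have "geometric_fps = fps_X * multiplicity_gf UNIV"
    by (rule fps_ext) (simp add: geometric_fps_def multiplicity_gf_def)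
  moreover have "(fps_X * multiplicity_gf UNIV) oo fps_X ^ m
      = fps_X ^ m * (multiplicity_gf UNIV oo fps_X ^ m)"
    using assms by (subst fps_compose_mult_distrib) simp_all
  ultimately show ?thesis by (simp only:)
qed

text \<open>The term \<open>q^m/(1 - q^m)\<close> starts with \<open>q^m\<close>. This triangularity
  makes the coefficients of a Lambert series recursively determined.\<close>

lemma mult_geometric_fps_compose_nth:
  assumes "n \<le> m" "m > 0"
  shows "(P * (geometric_fps oo fps_X ^ m)) $ n = (if n = m then P $ 0 else 0)"
proof -
  have "P * (geometric_fps oo fps_X ^ m) = fps_X ^ m * (P * (multiplicity_gf UNIV oo fps_X ^ m))"
    using assms by (simp add: geometric_fps_compose mult.left_commute)
  then show ?thesis
    using assms by (simp only: fps_X_power_mult_nth) (simp add: multiplicity_gf_def)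
qed

section \<open>Lambert series for the logarithmic derivative\<close>

lemma partition_gf_UNIV_log_deriv:
  assumes "S \<subseteq> {0<..}"
  shows "int n * partition_gf UNIV S $ n =
    (\<Sum>s\<in>S \<inter> {1..n}. int s * (partition_gf UNIV S * (geometric_fps oo fps_X ^ s)) $ n)"
  unfolding partition_gf_size_sum using assms
  by (intro sum.cong refl arg_cong2[where f = "(*)"])
     (auto simp: restricted_partitions_weighted_sum multiplicity_gf_deriv[where Q = UNIV, simplified]
       multiplicity_gf_UNIV_deriv partition_gf_mult_compose)

text \<open>Each factor \<open>(1 - q^(rs))/(1 - q^s)\<close> contributes two Lambert terms to
  \<open>q P'(q)/P(q)\<close>, one at \<open>s\<close> and one, negative, at
  \<open>r * s\<close>.\<close>

lemma partition_gf_lessThan_log_deriv: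
  assumes "S \<subseteq> {0<..}" "r > 0"
  defines "P \<equiv> partition_gf {..<r} S"
  shows "int n * P $ n = (\<Sum>s\<in>S \<inter> {1..n}. int s * (P * (geometric_fps oo fps_X ^ s)) $ n)
    - (\<Sum>s\<in>S \<inter> {1..n}. int (r * s) * (P * (geometric_fps oo fps_X ^ (r * s))) $ n)"
proof -
  have "(\<Sum>xs\<in>restricted_partitions {..<r} S n. int (count_list xs s)) =
      (P * (geometric_fps oo fps_X ^ s)) $ n - int r * (P * (geometric_fps oo fps_X ^ (r * s))) $ n"
    if s: "s \<in> S \<inter> {1..n}" for s
  proof -
    have s': "s > 0" "s \<in> S" "0 \<in> {..<r}" using s \<open>r > 0\<close> by auto
    have "(geometric_fps oo fps_X ^ r) oo fps_X ^ s = geometric_fps oo fps_X ^ (r * s)"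
      using s' by (intro fps_ext) (auto simp: fps_compose_X_power_nth geometric_fps_def
          div_mult2_eq mult.commute elim!: dvdE)
    then have K: "(geometric_fps - of_nat r * (geometric_fps oo fps_X ^ r)) oo fps_X ^ s =
        (geometric_fps oo fps_X ^ s) - of_nat r * (geometric_fps oo fps_X ^ (r * s))"
      using s' by (simp add: fps_compose_sub_distrib fps_compose_mult_distrib flip: fps_of_nat)
    have "(\<Sum>xs\<in>restricted_partitions {..<r} S n. int (count_list xs s)) =
        (P * ((geometric_fps oo fps_X ^ s) - of_nat r * (geometric_fps oo fps_X ^ (r * s)))) $ n"
      unfolding restricted_partitions_weighted_sum[OF s'] multiplicity_gf_deriv
        multiplicity_gf_lessThan_deriv[OF \<open>r > 0\<close>] partition_gf_mult_compose[OF s'] K P_def ..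
    then show ?thesis
      by (simp add: right_diff_distrib mult.left_commute[of P] flip: fps_of_nat)
  qed
  then show ?thesis
    unfolding P_def partition_gf_size_sum
    by (simp add: sum_subtractf[symmetric] right_diff_distrib mult_ac)
qed

section \<open>Consequences of the equality of the generating functions\<close>

lemma Euler_pair_partition_gf:
  assumes "r > 0" "Euler_pair r S1 S2"
  shows "partition_gf UNIV S2 = partition_gf {..<r} S1"
  using assms by (intro fps_ext) (simp add: Euler_pair_def part_D_eq part_O_eq partition_gf_def)

text \<open>Since the right-hand side is nonnegative, this encodes both \<open>r S1 \<subseteq> S1\<close> and
  \<open>S2 = S1 - r S1\<close>.\<close>

theorem Subbarao:
  assumes "r > 0" "Euler_pair r S1 S2" "n > 0"
  shows "of_bool (n \<in> S1) - of_bool (n \<in> (*) r ` S1) = (of_bool (n \<in> S2) :: int)"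
  using \<open>n > 0\<close>
proof (induction n rule: less_induct)
  case (less n)
  \<comment> \<open>\<open>\<epsilon>\<close> is the defect in the claim; \<open>f m\<close> is the
    coefficient at \<open>n\<close> of \<open>P\<close> times the Lambert term of weight
    \<open>m\<close>.\<close>
  define \<epsilon> :: "nat \<Rightarrow> int"
    where "\<epsilon> m = of_bool (m \<in> S1) - of_bool (m \<in> (*) r ` S1) - of_bool (m \<in> S2)" for m
  define P where "P = partition_gf {..<r} S1"
  define f where "f m = int m * (P * (geometric_fps oo fps_X ^ m)) $ n" for m
  have S: "S1 \<subseteq> {0<..}" "S2 \<subseteq> {0<..}" using assms by (auto simp: Euler_pair_def)
  have f0: "f m = 0" if "m > n" for m
    using that by (simp add: f_def mult_geometric_fps_compose_nth)
  have dilate: "(\<Sum>s\<in>S1 \<inter> {1..n}. f (r * s)) = (\<Sum>m\<in>(*) r ` S1 \<inter> {1..n}. f m)"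
    using \<open>r > 0\<close> S(1) f0 by (rule sum_dilate)
  have "int n * P $ n = (\<Sum>s\<in>S1 \<inter> {1..n}. f s) - (\<Sum>s\<in>S1 \<inter> {1..n}. f (r * s))"
    using partition_gf_lessThan_log_deriv[OF S(1) \<open>r > 0\<close>] by (simp add: f_def P_def)
  moreover have "int n * P $ n = (\<Sum>s\<in>S2 \<inter> {1..n}. f s)"
    using partition_gf_UNIV_log_deriv[OF S(2)] Euler_pair_partition_gf[OF assms(1,2)]
    by (simp add: f_def P_def)
  ultimately have "0 = (\<Sum>m=1..n. \<epsilon> m * f m)"
    unfolding dilate unfolding sum_Int_of_bool
    by (simp only: \<epsilon>_def left_diff_distrib sum_subtractf)
  \<comment> \<open>The induction hypothesis removes every term with
    \<open>0 < m < n\<close>.\<close>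
  also have "\<dots> = (\<Sum>m=1..n. if m = n then \<epsilon> n * f n else 0)"
    using less.IH by (intro sum.cong) (auto simp: \<epsilon>_def)
  \<comment> \<open>Here \<open>f n = n\<close>, because \<open>P\<close> has constant term 1 (the
    empty partition); as \<open>n > 0\<close>, the defect must vanish.\<close>
  also have "\<dots> = \<epsilon> n * int n"
    using \<open>n > 0\<close> by (simp add: f_def mult_geometric_fps_compose_nth P_def partition_gf_nth_0)
  finally show ?case using \<open>n > 0\<close> by (simp add: \<epsilon>_def)
qed

section \<open>Comparing the numbers of different parts\<close>

theorem theorem1p3:
  fixes n r :: nat and S1 S2 :: "nat set"
  assumes "r \<ge> 2" and "Euler_pair r S1 S2"
  shows "int (c' S1 r n) = b' S1 S2 r n"
proof -
  have r: "r > 0" and S: "S1 \<subseteq> {0<..}" "S2 \<subseteq> {0<..}"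
    using assms by (auto simp: Euler_pair_def)
  define P where "P = partition_gf {..<r} S1"
  define f where "f m = (P * fps_X ^ m) $ n" for m
  have f0: "f m = 0" if "m > n" for m
    using that by (simp add: f_def fps_X_power_mult_right_nth)
  have dilate: "(\<Sum>s\<in>S1 \<inter> {1..n}. f (r * s)) = (\<Sum>m\<in>(*) r ` S1 \<inter> {1..n}. f m)"
    using r S(1) f0 by (rule sum_dilate)
  have "(\<Sum>xs\<in>part_O S2 n. int (num_distinct_parts xs)) = (\<Sum>s\<in>S2 \<inter> {1..n}. f s)"
    unfolding part_O_eq sum_num_distinct_parts
  proof (rule sum.cong[OF refl])
    fix s assume "s \<in> S2 \<inter> {1..n}"
    then have s: "s > 0" "s \<in> S2" "(0::nat) \<in> UNIV" by auto
    show "(\<Sum>xs\<in>restricted_partitions UNIV S2 n. of_bool (count_list xs s > 0)) = f s"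
      unfolding restricted_partitions_weighted_sum[OF s, where w = "\<lambda>k. of_bool (k > 0)"]
        positive_multiplicity_UNIV partition_gf_mult_compose[OF s]
        Euler_pair_partition_gf[OF r assms(2)]
      using s by (simp add: f_def P_def)
  qed
  \<comment> \<open>The subtraction is done for each \<open>s\<close> separately: the combined
    weight series is \<open>multiplicity_gf {..<r}\<close> times \<open>q - q^r\<close>, and
    \<open>q^s\<close> for \<open>q\<close> yields the exponents \<open>s\<close> and
    \<open>r * s\<close>.\<close>
  moreover have "(\<Sum>xs\<in>part_D S1 r n. int (num_distinct_parts xs)) - int (c' S1 r n) =
      (\<Sum>s\<in>S1 \<inter> {1..n}. f s) - (\<Sum>s\<in>S1 \<inter> {1..n}. f (r * s))"
    unfolding part_D_eq[OF r] sum_num_distinct_parts c'_def card_part_T[OF S(1)]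
      sum_subtractf[symmetric]
  proof (rule sum.cong[OF refl])
    fix s assume "s \<in> S1 \<inter> {1..n}"
    then have s: "s > 0" "s \<in> S1" "0 \<in> {..<r}" using r by auto
    show "(\<Sum>xs\<in>restricted_partitions {..<r} S1 n. of_bool (count_list xs s > 0)) -
        (partition_gf {..<r} (S1 - {s}) *
          (Abs_fps (\<lambda>k. of_bool (r < k \<and> k < 2 * r)) oo fps_X ^ s)) $ n = f s - f (r * s)"
      unfolding restricted_partitions_weighted_sum[OF s, where w = "\<lambda>k. of_bool (k > 0)"]
        fps_sub_nth[symmetric] right_diff_distrib[symmetric] fps_compose_sub_distrib[symmetric]
        positive_multiplicity_lessThan[OF r] partition_gf_mult_compose[OF s]
      using s by (simp add: f_def P_def fps_compose_sub_distrib right_diff_distrib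
          power_mult mult.commute[of r] flip: fps_compose_power)
  qed
  \<comment> \<open>With all sums over \<open>{1..n}\<close>, the identity of indicator functions
    applies termwise.\<close>
  moreover have "(\<Sum>m=1..n. of_bool (m \<in> S1) * f m) - (\<Sum>m=1..n. of_bool (m \<in> (*) r ` S1) * f m)
      = (\<Sum>m=1..n. of_bool (m \<in> S2) * f m)"
    unfolding sum_subtractf[symmetric] left_diff_distrib[symmetric]
    using Subbarao[OF r assms(2)] by (intro sum.cong) auto
  ultimately show ?thesis
    unfolding b'_def dilate unfolding sum_Int_of_bool by linarith
qed

end
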